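(* Let $k_E/k_F$ be an extension of finite fields of degree $r$ and $\psi$ a nontrivial additive character of $k_F$. For every integer $n\ge0$ and every $a\in k_F^\times$, \[\mathrm{Kl}^{n,r}_a(\psi;k_E/k_F)=(-1)^{r-1}\mathrm{Kl}^{n+1,0}_a(\psi;k_E/k_F).\]
   Context: $\mathrm{Nr},\mathrm{Tr}$ are the norm and trace of $k_E/k_F$. For $a\in k_F^\times$ and integers $n,m\ge0$, $\mathrm{Kl}^{n,m}_a(\psi;k_E/k_F)=\sum\psi\circ\mathrm{Tr}(t_1+\cdots+t_n)\cdot\psi(s_1+\cdots+s_m)$, the sum over $t_1,\ldots,t_n\in k_E$ and $s_1,\ldots,s_m\in k_F$ with $\mathrm{Nr}(t_1)\cdots\mathrm{Nr}(t_n)s_1\cdots s_m=a$. *)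

theory Defs
  imports Complex_Main "HOL-Library.FuncSet" "HOL-Library.Cardinality"
begin

text \<open>A finite field extension k_E/k_F is modelled by two finite field types 'f, 'e
  and a ring embedding iota : 'f -> 'e, with CARD('e) = CARD('f)^r.\<close>

definition fin_trace :: "('f::{finite,field} \<Rightarrow> 'e::{finite,field}) \<Rightarrow> nat \<Rightarrow> 'e \<Rightarrow> 'f" where
  "fin_trace \<iota> r x = inv \<iota> (\<Sum>i<r. x ^ (CARD('f) ^ i))"

definition fin_norm :: "('f::{finite,field} \<Rightarrow> 'e::{finite,field}) \<Rightarrow> nat \<Rightarrow> 'e \<Rightarrow> 'f" where
  "fin_norm \<iota> r x = inv \<iota> (\<Prod>i<r. x ^ (CARD('f) ^ i))"

definition Kl :: "('f::{finite,field} \<Rightarrow> complex) \<Rightarrow> ('f \<Rightarrow> 'e::{finite,field}) \<Rightarrow> nat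
    \<Rightarrow> nat \<Rightarrow> nat \<Rightarrow> 'f \<Rightarrow> complex" where
  "Kl \<psi> \<iota> r n m a =
     (\<Sum>(t, s) \<in> {(t, s). t \<in> ({..<n} \<rightarrow>\<^sub>E (UNIV :: 'e set)) \<and> s \<in> ({..<m} \<rightarrow>\<^sub>E (UNIV :: 'f set)) \<and>
                        (\<Prod>i<n. fin_norm \<iota> r (t i)) * (\<Prod>j<m. s j) = a}.
        \<psi> (fin_trace \<iota> r (\<Sum>i<n. t i)) * \<psi> (\<Sum>j<m. s j))"

end

theory Submission
  imports Defs "HOL-Computational_Algebra.Polynomial_Factorial" "HOL-Library.Poly_Mapping"
begin

text \<open>
  Work in the monoid algebra C[(k_F, *)] of the multiplicative monoid of k_F. For a monic
  f = X^n + a_1 X^(n-1) + ... + a_n over k_F put lambda(f) = psi(-a_1) [(-1)^n a_n]. This is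
  multiplicative, and its sum over the monics of degree n is 1, gamma = sum_s psi(s) [s], 0 for
  n = 0, 1, >= 2. Comparing logarithmic derivatives of 1 + gamma T with the Euler product over
  monic irreducibles P yields  sum_{k deg P = m} deg P lambda(P)^k = -(-gamma)^m.
  For m = r the left side is epsilon = sum_{t in k_E} psi(Tr t) [Nr t]: the characteristic
  polynomial of t over k_F is P^k with P the minimal polynomial of t, its coefficients give
  Nr t and Tr t, and each such P^k arises from exactly deg P elements t. As Kl^{n,m}_a is the
  coefficient of [a] in epsilon^n gamma^m, the identity epsilon = (-1)^(r-1) gamma^r gives the claim.
\<close>

section \<open>Finite fields\<close>

lemma card_finite_pos [simp]: "0 < CARD('a :: finite)"
  by (simp add: finite_UNIV_card_ge_0)

lemma power_card_eq_self:
  fixes x :: "'a :: {finite, field}"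
  shows "x ^ CARD('a) = x"
proof (cases "x = 0")
  case False
  let ?U = "UNIV - {0} :: 'a set"
  have "x ^ card ?U * \<Prod>?U = (\<Prod>y\<in>?U. x * y)"
    by (simp only: prod.distrib prod_constant)
  also have "\<dots> = \<Prod>?U"
    by (rule prod.reindex_bij_witness[of _ "\<lambda>y. y / x" "\<lambda>y. x * y"]) (use False in auto)
  finally have "x ^ card ?U = 1"
    by simp
  moreover have "CARD('a) = Suc (card ?U)"
    using finite_UNIV_card_ge_0[where 'a = 'a] by (simp add: card_Diff_singleton)
  hence "x ^ CARD('a) = x * x ^ card ?U"
    by (simp only: power_Suc)
  ultimately show ?thesis
    by simp
qed (use finite_UNIV_card_ge_0[where 'a = 'a] in simp)

lemma power_card_power_eq_self:
  fixes x :: "'a :: {finite, field}"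
  shows "x ^ (CARD('a) ^ n) = x"
  by (induction n) (simp_all add: power_card_eq_self power_mult)

lemma card_field_ge_2: "CARD('a :: {finite, field}) \<ge> 2"
proof -
  have "card {0, 1 :: 'a} \<le> CARD('a)"
    by (intro card_mono) auto
  thus ?thesis
    by simp
qed

text \<open>
  The polynomial \<open>(X + 1)\<^sup>q - X\<^sup>q - 1\<close> has degree \<open>< q\<close> and vanishes on all \<open>q\<close> elements,
  so it is zero; its coefficients are the binomial coefficients \<open>q choose i\<close>.
\<close>
lemma of_nat_card_choose_eq_0:
  assumes "0 < i" "i < CARD('a :: {finite, field})"
  shows "of_nat (CARD('a) choose i) = (0 :: 'a)"
proof -
  define q where "q = CARD('a)"
  define p :: "'a poly" where "p = [:1, 1:] ^ q - monom 1 q - 1"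
  have q2: "q \<ge> 2"
    using card_field_ge_2[where 'a = 'a] by (simp add: q_def)
  have coeff_binomial: "coeff ([:1, 1 :: 'a:] ^ q) j = of_nat (q choose j)" for j
  proof (cases "j \<le> q")
    case False
    have "degree ([:1, 1 :: 'a:] ^ q) \<le> q"
      using degree_power_le[of "[:1, 1 :: 'a:]" q] by simp
    with False show ?thesis
      by (simp add: coeff_eq_0 binomial_eq_0)
  qed (use coeff_linear_poly_power[of j q 1 1] in simp)
  have coeff_p: "coeff p j = of_nat (q choose j) - (if j = q then 1 else 0) - (if j = 0 then 1 else 0)" for j
    by (simp add: p_def coeff_binomial coeff_monom coeff_1)
  have "p = 0"
  proof (rule ccontr)
    assume "p \<noteq> 0"
    have "degree p \<le> q - 1"
      using q2 by (intro degree_le) (auto simp: coeff_p binomial_eq_0)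
    moreover have "poly p x = 0" for x
      using power_card_eq_self[of "x + 1"] power_card_eq_self[of x]
      by (simp add: p_def q_def poly_monom algebra_simps)
    hence "q \<le> degree p"
      using card_poly_roots_bound[OF \<open>p \<noteq> 0\<close>] by (simp add: q_def)
    ultimately show False
      using q2 by simp
  qed
  hence "coeff p i = 0"
    by simp
  thus ?thesis
    using assms by (simp add: coeff_p q_def)
qed

section \<open>Polynomials\<close>

lemma map_poly_hom_mult:
  fixes h :: "'a::comm_ring_1 \<Rightarrow> 'b::comm_ring_1"
  assumes add: "\<And>x y. h (x + y) = h x + h y" and mult: "\<And>x y. h (x * y) = h x * h y"
    and zero: "h 0 = 0"
  shows "map_poly h (p * q) = map_poly h p * map_poly h q"
proof (rule poly_eqI)
  fix n
  have h_sum: "h (sum g A) = (\<Sum>x\<in>A. h (g x))" for g :: "nat \<Rightarrow> 'a" and A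
    by (induction A rule: infinite_finite_induct) (auto simp: add zero)
  show "coeff (map_poly h (p * q)) n = coeff (map_poly h p * map_poly h q) n"
    by (simp add: coeff_map_poly zero coeff_mult h_sum mult)
qed

lemma map_poly_hom_prod:
  fixes h :: "'a::comm_ring_1 \<Rightarrow> 'b::comm_ring_1"
  assumes "\<And>x y. h (x + y) = h x + h y" and "\<And>x y. h (x * y) = h x * h y"
    and "h 0 = 0" and one: "h 1 = 1"
  shows "map_poly h (prod f A) = (\<Prod>x\<in>A. map_poly h (f x))"
  by (induction A rule: infinite_finite_induct) (auto simp: map_poly_hom_mult[OF assms(1-3)] one)

lemma map_poly_hom_power:
  fixes h :: "'a::comm_ring_1 \<Rightarrow> 'b::comm_ring_1"
  assumes "\<And>x y. h (x + y) = h x + h y" and "\<And>x y. h (x * y) = h x * h y"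
    and "h 0 = 0" and one: "h 1 = 1"
  shows "map_poly h (p ^ k) = map_poly h p ^ k"
  by (induction k) (auto simp: map_poly_hom_mult[OF assms(1-3)] one)

lemma coeff_reflect_poly_1_mult:
  fixes f g :: "'a::idom poly"
  assumes "lead_coeff f = 1" "lead_coeff g = 1"
  shows "coeff (reflect_poly (f * g)) 1 = coeff (reflect_poly f) 1 + coeff (reflect_poly g) 1"
proof -
  have "coeff (reflect_poly (f * g)) 1 = coeff (reflect_poly f * reflect_poly g) 1"
    by (simp add: reflect_poly_mult)
  also have "\<dots> = (\<Sum>i\<le>1. coeff (reflect_poly f) i * coeff (reflect_poly g) (1 - i))"
    by (rule coeff_mult)
  also have "\<dots> = coeff (reflect_poly f) 0 * coeff (reflect_poly g) 1 + coeff (reflect_poly f) 1 * coeff (reflect_poly g) 0"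
    by (simp add: atMost_Suc)
  finally show ?thesis
    using assms by simp
qed

lemma irreducible_imp_degree_pos:
  fixes P :: "'a::field poly"
  assumes "irreducible P"
  shows "degree P \<ge> 1"
  using assms is_unit_iff_degree[of P] by (auto simp: irreducible_def)

context
begin

text \<open>
  Polynomials over an arbitrary field are not a \<open>factorial_semiring\<close> instance (that needs
  \<open>factorial_ring_gcd\<close> coefficients), so we interpret the Euclidean-semiring locale with
  normalisation to monic polynomials locally to get unique factorisation.
\<close>
interpretation fpoly:
  normalization_euclidean_semiring_multiplicative where zero = "0 :: 'a :: field poly"
    and one = 1 and plus = plus and minus = minus
    and times = times
    and normalize = "\<lambda>p. smult (inverse (lead_coeff p)) p"
    and unit_factor = "\<lambda>p. [:lead_coeff p:]"
    and euclidean_size = "\<lambda>p. if p = 0 then 0 else 2 ^ degree p"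
    and divide = divide and modulo = modulo
  rewrites "dvd.dvd (times :: 'a poly \<Rightarrow> _) = Rings.dvd"
    and "comm_monoid_mult.prod_mset times 1 = prod_mset"
    and "comm_semiring_1.irreducible times 1 0 = irreducible"
    and "comm_semiring_1.prime_elem times 1 0 = prime_elem"
    and "power.power (1 :: 'a poly) times = (^)"
proof -
  show "power.power (1 :: 'a poly) times = (^)"
  proof (intro ext)
    fix x :: "'a poly" and n :: nat
    show "power.power 1 (*) x n = x ^ n"
      by (induction n) (simp_all add: power.power.simps)
  qed
  show "dvd.dvd (times :: 'a poly \<Rightarrow> _) = Rings.dvd"
    by (simp add: dvd_dict)
  show "comm_monoid_mult.prod_mset times 1 = prod_mset"
    by (simp add: prod_mset_dict)
  show "comm_semiring_1.irreducible times 1 0 = irreducible"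
    by (simp add: irreducible_dict)
  show "comm_semiring_1.prime_elem times 1 0 = prime_elem"
    by (simp add: prime_elem_dict)
  show "class.normalization_euclidean_semiring_multiplicative divide plus minus (0 :: 'a poly) times 1
    modulo (\<lambda>p. if p = 0 then 0 else 2 ^ degree p)
    (\<lambda>p. [:lead_coeff p:]) (\<lambda>p. smult (inverse (lead_coeff p)) p)"
  proof (standard, fold dvd_dict)
    fix p :: "'a poly"
    show "[:lead_coeff p:] * smult (inverse (lead_coeff p)) p = p"
      by (cases "p = 0") simp_all
  next
    fix p :: "'a poly" assume "is_unit p"
    then show "[:lead_coeff p:] = p"
      by (elim is_unit_polyE) (auto simp: monom_0 one_poly_def field_simps)
  next
    fix p :: "'a poly" assume "p \<noteq> 0"
    then show "is_unit [:lead_coeff p:]"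
      by (simp add: is_unit_pCons_iff)
  next
    fix a b :: "'a poly" assume "is_unit a"
    thus "[:lead_coeff (a * b):] = a * [:lead_coeff b:]"
      by (auto elim!: is_unit_polyE)
  qed (auto simp: lead_coeff_mult Rings.div_mult_mod_eq intro!: degree_mod_less' degree_mult_right_le)
qed

lemma fpoly_prime_iff:
  fixes P :: "'a::field poly"
  shows "fpoly.prime P \<longleftrightarrow> irreducible P \<and> lead_coeff P = 1"
proof
  assume prime: "fpoly.prime P"
  hence "P \<noteq> 0" and "smult (inverse (lead_coeff P)) P = P"
    by (auto simp: fpoly.prime_def)
  hence "lead_coeff P = 1"
    by (metis lead_coeff_smult leading_coeff_0_iff left_inverse)
  with prime show "irreducible P \<and> lead_coeff P = 1"
    by (simp add: fpoly.prime_def fpoly.prime_elem_iff_irreducible)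
qed (simp add: fpoly.prime_def fpoly.prime_elem_iff_irreducible)

lemma degree_eq_sum_prime_power_divisors:
  fixes f :: "'a::field poly"
  assumes f: "lead_coeff f = 1"
  shows "degree f = (\<Sum>(P, k) \<in> {(P, k). irreducible P \<and> lead_coeff P = 1 \<and> 1 \<le> k \<and> P ^ k dvd f}. degree P)"
proof -
  define M where "M = fpoly.prime_factorization f"
  have "f \<noteq> 0"
    using f by auto
  have prime_M: "P \<in># M \<longleftrightarrow> fpoly.prime P \<and> P dvd f" for P
    using \<open>f \<noteq> 0\<close> by (auto simp: M_def fpoly.in_prime_factors_iff)
  have "(\<Prod>P\<in>set_mset M. P ^ count M P) = f"
    using fpoly.prod_mset_prime_factorization[OF \<open>f \<noteq> 0\<close>] f
    by (simp add: M_def prod_mset_multiplicity)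
  hence "degree f = degree (\<Prod>P\<in>set_mset M. P ^ count M P)"
    by (simp only:)
  also have "\<dots> = (\<Sum>P\<in>set_mset M. degree (P ^ count M P))"
    by (rule degree_prod_sum_eq) (auto simp: prime_M fpoly.prime_def)
  also have "\<dots> = (\<Sum>P\<in>set_mset M. \<Sum>k\<in>{1..fpoly.multiplicity P f}. degree P)"
    by (intro sum.cong refl)
      (auto simp: M_def fpoly.in_prime_factors_iff fpoly.count_prime_factorization_prime
        degree_power_eq fpoly.prime_def)
  also have "\<dots> = (\<Sum>(P, k) \<in> Sigma (set_mset M) (\<lambda>P. {1..fpoly.multiplicity P f}). degree P)"
    by (rule sum.Sigma) auto
  also have "Sigma (set_mset M) (\<lambda>P. {1..fpoly.multiplicity P f}) =
      {(P, k). irreducible P \<and> lead_coeff P = 1 \<and> 1 \<le> k \<and> P ^ k dvd f}"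
  proof -
    have "P ^ k dvd f \<longleftrightarrow> P dvd f \<and> k \<le> fpoly.multiplicity P f"
      if "fpoly.prime P" "1 \<le> k" for P k
    proof -
      have "\<not> is_unit P"
        using that(1) by (auto simp: fpoly.prime_def)
      hence "P ^ k dvd f \<longleftrightarrow> k \<le> fpoly.multiplicity P f"
        by (rule fpoly.power_dvd_iff_le_multiplicity[OF \<open>f \<noteq> 0\<close>])
      moreover have "P dvd P ^ k"
        using that(2) by simp
      ultimately show ?thesis
        by (blast intro: dvd_trans)
    qed
    thus ?thesis
      by (auto simp: prime_M fpoly_prime_iff)
  qed
  finally show ?thesis .
qed

end

section \<open>Monic polynomials and prime powers over a finite field\<close>

definition monics :: "nat \<Rightarrow> 'a::{finite,field} poly set" where
  "monics n = {f. lead_coeff f = 1 \<and> degree f = n}"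

definition prime_power_pairs :: "nat \<Rightarrow> ('a::{finite,field} poly \<times> nat) set" where
  "prime_power_pairs n = {(P, k). irreducible P \<and> lead_coeff P = 1 \<and> 1 \<le> k \<and> k * degree P = n}"

definition monic_of_coeffs :: "nat \<Rightarrow> (nat \<Rightarrow> 'a::comm_ring_1) \<Rightarrow> 'a poly" where
  "monic_of_coeffs n c = monom 1 n + (\<Sum>i<n. monom (c i) i)"

lemma coeff_monic_of_coeffs:
  "coeff (monic_of_coeffs n c) j = (if j = n then 1 else 0) + (if j < n then c j else 0)"
  by (simp add: monic_of_coeffs_def coeff_sum coeff_monom)

lemma monics_eq_image: "monics n = monic_of_coeffs n ` ({..<n} \<rightarrow>\<^sub>E UNIV)"
proof (intro equalityI subsetI)
  fix f :: "'a poly"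
  assume "f \<in> monics n"
  hence "f = monic_of_coeffs n (restrict (coeff f) {..<n})"
    by (intro poly_eqI) (auto simp: monics_def coeff_monic_of_coeffs coeff_eq_0)
  thus "f \<in> monic_of_coeffs n ` ({..<n} \<rightarrow>\<^sub>E UNIV)"
    by (rule image_eqI[where x = "restrict (coeff f) {..<n}"]) auto
next
  fix f :: "'a poly"
  assume "f \<in> monic_of_coeffs n ` ({..<n} \<rightarrow>\<^sub>E UNIV)"
  then obtain c where f: "f = monic_of_coeffs n c"
    by blast
  have "degree f = n"
    by (intro antisym degree_le le_degree) (auto simp: f coeff_monic_of_coeffs)
  thus "f \<in> monics n"
    by (simp add: monics_def f coeff_monic_of_coeffs)
qed

lemma inj_on_monic_of_coeffs: "inj_on (monic_of_coeffs n) ({..<n} \<rightarrow>\<^sub>E UNIV)"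
proof (rule inj_onI)
  fix c d :: "nat \<Rightarrow> 'a"
  assume c: "c \<in> {..<n} \<rightarrow>\<^sub>E UNIV" and d: "d \<in> {..<n} \<rightarrow>\<^sub>E UNIV"
    and eq: "monic_of_coeffs n c = monic_of_coeffs n d"
  show "c = d"
  proof (rule PiE_ext[OF c d])
    fix i :: nat
    assume "i \<in> {..<n}"
    thus "c i = d i"
      using arg_cong[OF eq, of "\<lambda>p. coeff p i"] by (simp add: coeff_monic_of_coeffs)
  qed
qed

lemma mem_monicsD:
  assumes "f \<in> monics n"
  shows "lead_coeff f = 1" and "degree f = n"
  using assms unfolding monics_def by blast+

lemma finite_monics [simp]: "finite (monics n)"
  unfolding monics_eq_image by (intro finite_imageI finite_PiE) auto

lemma card_monics: "card (monics n :: 'a::{finite,field} poly set) = CARD('a) ^ n"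
  by (simp add: monics_eq_image card_image[OF inj_on_monic_of_coeffs] card_PiE)

lemma finite_prime_power_pairs [simp]:
  "finite (prime_power_pairs n :: ('a::{finite,field} poly \<times> nat) set)"
proof (rule finite_subset)
  show "prime_power_pairs n \<subseteq> (\<Union>d\<le>n. monics d :: 'a poly set) \<times> {..n}"
  proof
    fix x :: "'a poly \<times> nat"
    assume "x \<in> prime_power_pairs n"
    then obtain P k where x: "x = (P, k)"
      and P: "irreducible P" "lead_coeff P = 1" "1 \<le> k" "k * degree P = n"
      by (auto simp: prime_power_pairs_def)
    have "degree P \<ge> 1"
      using P(1) by (rule irreducible_imp_degree_pos)
    with P(3,4) have "degree P \<le> n" "k \<le> n"
      by (metis le_trans mult_le_mono1 mult_1 mult_le_mono2 mult_1_right)+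
    with P x show "x \<in> (\<Union>d\<le>n. monics d) \<times> {..n}"
      by (auto simp: monics_def)
  qed
qed auto

definition prime_power_pairs_upto :: "nat \<Rightarrow> ('a::{finite,field} poly \<times> nat) set" where
  "prime_power_pairs_upto n = {(P, k). irreducible P \<and> lead_coeff P = 1 \<and> 1 \<le> k \<and> k * degree P \<le> n}"

lemma prime_power_pairs_upto_eq_UN:
  "prime_power_pairs_upto n = (\<Union>m\<in>{1..n}. prime_power_pairs m)"
proof -
  have "1 \<le> k * degree P" if "irreducible P" "1 \<le> k" for P :: "'a poly" and k
    using that irreducible_imp_degree_pos[of P] by (simp add: Suc_le_eq)
  thus ?thesis
    by (auto simp: prime_power_pairs_upto_def prime_power_pairs_def)
qed

lemma finite_prime_power_pairs_upto [simp]: "finite (prime_power_pairs_upto n)"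
  by (simp add: prime_power_pairs_upto_eq_UN)

section \<open>Sums of multiplicative functions over monic polynomials\<close>

definition monic_multiplicative :: "('a::field poly \<Rightarrow> 'r::comm_ring_1) \<Rightarrow> bool" where
  "monic_multiplicative w \<longleftrightarrow> w 1 = 1 \<and>
     (\<forall>f g. lead_coeff f = 1 \<longrightarrow> lead_coeff g = 1 \<longrightarrow> w (f * g) = w f * w g)"

lemma monic_multiplicativeD:
  assumes "monic_multiplicative w"
  shows "w 1 = 1" and "lead_coeff f = 1 \<Longrightarrow> lead_coeff g = 1 \<Longrightarrow> w (f * g) = w f * w g"
  using assms by (simp_all add: monic_multiplicative_def)

lemma monic_multiplicative_power:
  assumes w: "monic_multiplicative w" and P: "lead_coeff P = 1"
  shows "w (P ^ k) = w P ^ k"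
proof (induction k)
  case (Suc k)
  have "w (P * P ^ k) = w P * w (P ^ k)"
    using P by (intro monic_multiplicativeD(2)[OF w]) (simp_all add: lead_coeff_power)
  with Suc show ?case
    by simp
qed (simp add: monic_multiplicativeD(1)[OF w])

lemma sum_monics_multiples:
  fixes w :: "'a::{finite,field} poly \<Rightarrow> 'r::comm_ring_1"
  assumes w: "monic_multiplicative w" and P: "lead_coeff P = 1" and kn: "k * degree P \<le> n"
  shows "(\<Sum>f\<in>{f\<in>monics n. P ^ k dvd f}. w f) = w P ^ k * (\<Sum>h\<in>monics (n - k * degree P). w h)"
proof -
  have lead_Pk: "lead_coeff (P ^ k) = 1"
    using P by (simp add: lead_coeff_power)
  have "P \<noteq> 0"
    using P by auto
  hence "P ^ k \<noteq> 0" and deg_Pk: "degree (P ^ k) = k * degree P"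
    by (simp_all add: degree_power_eq)
  have multiples: "{f\<in>monics n. P ^ k dvd f} = (\<lambda>h. P ^ k * h) ` monics (n - k * degree P)"
  proof (intro equalityI subsetI)
    fix f
    assume f: "f \<in> {f\<in>monics n. P ^ k dvd f}"
    then obtain h where h: "f = P ^ k * h"
      by (auto elim: dvdE)
    with f have "h \<noteq> 0"
      by (auto simp: monics_def)
    with f h lead_Pk deg_Pk \<open>P ^ k \<noteq> 0\<close> have "h \<in> monics (n - k * degree P)"
      by (auto simp: monics_def lead_coeff_mult degree_mult_eq)
    with h show "f \<in> (\<lambda>h. P ^ k * h) ` monics (n - k * degree P)"
      by blast
  next
    fix f
    assume "f \<in> (\<lambda>h. P ^ k * h) ` monics (n - k * degree P)"
    then obtain h where f_eq: "f = P ^ k * h" and h: "h \<in> monics (n - k * degree P)"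
      by blast
    have lead_h: "lead_coeff h = 1" and deg_h: "degree h = n - k * degree P"
      using h unfolding monics_def by blast+
    hence "h \<noteq> 0"
      by auto
    have "lead_coeff f = 1"
      unfolding f_eq lead_coeff_mult lead_h lead_Pk by simp
    moreover have "degree f = n"
      using kn \<open>h \<noteq> 0\<close> \<open>P ^ k \<noteq> 0\<close> unfolding f_eq by (simp add: degree_mult_eq deg_h deg_Pk)
    ultimately show "f \<in> {f\<in>monics n. P ^ k dvd f}"
      by (simp add: monics_def f_eq)
  qed
  have "inj_on (\<lambda>h. P ^ k * h) (monics (n - k * degree P))"
    using \<open>P \<noteq> 0\<close> by (intro inj_onI) simp
  hence "(\<Sum>f\<in>{f\<in>monics n. P ^ k dvd f}. w f) = (\<Sum>h\<in>monics (n - k * degree P). w (P ^ k * h))"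
    by (simp add: multiples sum.reindex)
  also have "\<dots> = (\<Sum>h\<in>monics (n - k * degree P). w P ^ k * w h)"
  proof (rule sum.cong[OF refl])
    fix h :: "'a poly"
    assume "h \<in> monics (n - k * degree P)"
    hence "lead_coeff h = 1"
      by (rule mem_monicsD)
    thus "w (P ^ k * h) = w P ^ k * w h"
      by (simp add: monic_multiplicativeD(2)[OF w lead_Pk] monic_multiplicative_power[OF w P])
  qed
  finally show ?thesis
    by (simp add: sum_distrib_left)
qed

lemma degree_eq_sum_prime_power_pairs_dvd:
  fixes f :: "'a::{finite,field} poly"
  assumes f: "f \<in> monics n"
  shows "n = (\<Sum>x\<in>{x\<in>prime_power_pairs_upto n. fst x ^ snd x dvd f}. degree (fst x))"
proof -
  have "lead_coeff f = 1" "f \<noteq> 0" "degree f = n"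
    using f by (auto simp: monics_def)
  have "k * degree P \<le> n" if "P ^ k dvd f" "irreducible P" for P :: "'a poly" and k
    using dvd_imp_degree[OF that(1)] that \<open>f \<noteq> 0\<close> \<open>degree f = n\<close>
    by (simp add: degree_power_eq mult.commute irreducible_def)
  hence "{(P, k). irreducible P \<and> lead_coeff P = 1 \<and> 1 \<le> k \<and> P ^ k dvd f} =
      {x\<in>prime_power_pairs_upto n. fst x ^ snd x dvd f}"
    by (auto simp: prime_power_pairs_upto_def)
  moreover have "degree f = (\<Sum>(P, k) \<in> {(P, k). irreducible P \<and> lead_coeff P = 1 \<and> 1 \<le> k \<and> P ^ k dvd f}. degree P)"
    by (rule degree_eq_sum_prime_power_divisors[OF \<open>lead_coeff f = 1\<close>])
  ultimately show ?thesis
    using \<open>degree f = n\<close> by (simp add: case_prod_beta)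
qed

text \<open>
  Coefficientwise form of the logarithmic derivative of the Euler product
  sum_f w(f) T^(deg f) = prod_P (1 - w(P) T^(deg P))^(-1): both sides sum over pairs of a
  monic f and a prime power P^k dividing it, with weight deg P.
\<close>
lemma monics_log_derivative:
  fixes w :: "'a::{finite,field} poly \<Rightarrow> 'r::comm_ring_1"
  assumes w: "monic_multiplicative w"
  shows "of_nat n * (\<Sum>f\<in>monics n. w f) =
    (\<Sum>m\<in>{1..n}. (\<Sum>x\<in>prime_power_pairs m. of_nat (degree (fst x)) * w (fst x) ^ snd x) *
                 (\<Sum>f\<in>monics (n - m). w f))"
proof -
  define U :: "('a poly \<times> nat) set" where "U = prime_power_pairs_upto n"
  have "of_nat n * (\<Sum>f\<in>monics n. w f) =
      (\<Sum>f\<in>monics n. \<Sum>x\<in>{x\<in>U. fst x ^ snd x dvd f}. of_nat (degree (fst x)) * w f)"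
    unfolding sum_distrib_left U_def
    by (intro sum.cong refl) (subst (1) degree_eq_sum_prime_power_pairs_dvd; simp add: sum_distrib_right)
  also have "\<dots> = (\<Sum>x\<in>U. \<Sum>f\<in>{f\<in>monics n. fst x ^ snd x dvd f}. of_nat (degree (fst x)) * w f)"
    by (rule sum.swap_restrict) (simp_all add: U_def)
  also have "\<dots> = (\<Sum>x\<in>U. of_nat (degree (fst x)) * w (fst x) ^ snd x *
                            (\<Sum>f\<in>monics (n - snd x * degree (fst x)). w f))"
    by (intro sum.cong refl)
      (auto simp: U_def prime_power_pairs_upto_def sum_distrib_left[symmetric] sum_monics_multiples[OF w])
  also have "\<dots> = (\<Sum>m\<in>{1..n}. \<Sum>x\<in>prime_power_pairs m. of_nat (degree (fst x)) * w (fst x) ^ snd x *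
                            (\<Sum>f\<in>monics (n - snd x * degree (fst x)). w f))"
    unfolding U_def prime_power_pairs_upto_eq_UN
    by (rule sum.UNION_disjoint) (simp, simp, auto simp: prime_power_pairs_def)
  also have "\<dots> = (\<Sum>m\<in>{1..n}. \<Sum>x\<in>prime_power_pairs m. of_nat (degree (fst x)) * w (fst x) ^ snd x *
                            (\<Sum>f\<in>monics (n - m). w f))"
    by (intro sum.cong refl) (auto simp: prime_power_pairs_def)
  finally show ?thesis
    by (simp add: sum_distrib_right)
qed

text \<open>Gauss's count of monic irreducibles, from the case \<open>w = 1\<close> of the recurrence.\<close>
lemma sum_degree_prime_power_pairs:
  assumes "n \<ge> 1"
  shows "(\<Sum>x\<in>(prime_power_pairs n :: ('a::{finite,field} poly \<times> nat) set). degree (fst x)) = CARD('a) ^ n"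
proof -
  define N where "N m = (\<Sum>x\<in>(prime_power_pairs m :: ('a poly \<times> nat) set). int (degree (fst x)))" for m
  define q where "q = int CARD('a)"
  have recurrence: "int m * q ^ m = (\<Sum>j\<in>{1..m}. N j * q ^ (m - j))" for m
    using monics_log_derivative[of "\<lambda>_. 1 :: int" m]
    by (simp add: monic_multiplicative_def card_monics N_def q_def)
  have "N m = q ^ m" if "1 \<le> m" for m
    using that
  proof (induction m rule: less_induct)
    case (less m)
    have "{1..m} = insert m {1..m - 1}"
      using less.prems by auto
    hence "int m * q ^ m = N m + (\<Sum>j\<in>{1..m - 1}. N j * q ^ (m - j))"
      using recurrence[of m] less.prems by simp
    also have "(\<Sum>j\<in>{1..m - 1}. N j * q ^ (m - j)) = (\<Sum>j\<in>{1..m - 1}. q ^ m)"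
      by (intro sum.cong refl) (auto simp: less.IH power_add[symmetric])
    finally show ?case
      using less.prems by (simp add: algebra_simps of_nat_diff)
  qed
  with assms have "int (\<Sum>x\<in>(prime_power_pairs n :: ('a poly \<times> nat) set). degree (fst x)) = int (CARD('a) ^ n)"
    by (simp add: N_def q_def)
  thus ?thesis
    by (simp only: of_nat_eq_iff)
qed

section \<open>The monoid algebra of the multiplicative monoid\<close>

text \<open>
  \<open>Poly_Mapping\<close> multiplies by convolution over an additive monoid, so a multiplicative
  monoid is copied into a type with its multiplication written as \<open>+\<close>; then
  \<open>'a mult \<Rightarrow>\<^sub>0 complex\<close> is the monoid algebra \<open>\<complex>[('a, *)]\<close>.
\<close>
typedef 'a mult = "UNIV :: 'a set"
  morphisms of_mult Mult
  by auto

lemma Mult_eq_iff [simp]: "Mult x = Mult y \<longleftrightarrow> x = y"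
  by (simp add: Mult_inject)

instantiation mult :: (comm_monoid_mult) comm_monoid_add
begin

definition zero_mult :: "'a mult" where
  "zero_mult = Mult 1"

definition plus_mult :: "'a mult \<Rightarrow> 'a mult \<Rightarrow> 'a mult" where
  "plus_mult a b = Mult (of_mult a * of_mult b)"

instance
  by standard (simp_all add: plus_mult_def zero_mult_def Mult_inverse of_mult_inverse mult_ac)

end

type_synonym 'a monoid_alg = "'a mult \<Rightarrow>\<^sub>0 complex"

lemma Mult_1 [simp]: "Mult 1 = 0"
  by (simp add: zero_mult_def)

lemma single_Mult_mult:
  "Poly_Mapping.single (Mult x) a * Poly_Mapping.single (Mult y) b = Poly_Mapping.single (Mult (x * y)) (a * b)"
  by (simp add: mult_single plus_mult_def Mult_inverse)

lemma prod_single_Mult: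
  "(\<Prod>i\<in>A. Poly_Mapping.single (Mult (x i)) (c i)) =
     Poly_Mapping.single (Mult (\<Prod>i\<in>A. x i)) (\<Prod>i\<in>A. c i :: complex)"
  by (induction A rule: infinite_finite_induct) (auto simp: single_Mult_mult)

lemma power_sum_single_Mult:
  fixes x :: "'b::finite \<Rightarrow> 'a::comm_monoid_mult" and c :: "'b \<Rightarrow> complex"
  shows "(\<Sum>t\<in>UNIV. Poly_Mapping.single (Mult (x t)) (c t)) ^ n =
    (\<Sum>t\<in>{..<n} \<rightarrow>\<^sub>E UNIV. Poly_Mapping.single (Mult (\<Prod>i<n. x (t i))) (\<Prod>i<n. c (t i)))"
proof -
  have "(\<Sum>t\<in>UNIV. Poly_Mapping.single (Mult (x t)) (c t)) ^ n =
      (\<Prod>i<n. \<Sum>t\<in>UNIV. Poly_Mapping.single (Mult (x t)) (c t))"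
    by simp
  also have "\<dots> = (\<Sum>t\<in>{..<n} \<rightarrow>\<^sub>E UNIV. \<Prod>i<n. Poly_Mapping.single (Mult (x (t i))) (c (t i)))"
    by (rule prod_sum_PiE) auto
  finally show ?thesis
    by (simp add: prod_single_Mult)
qed

lemma lookup_neg_one_power_mult:
  "Poly_Mapping.lookup ((-1) ^ k * p) x = (-1) ^ k * Poly_Mapping.lookup (p :: 'a::comm_monoid_add \<Rightarrow>\<^sub>0 complex) x"
  by (induction k) (simp_all add: lookup_uminus)

section \<open>An additive character on monic polynomials\<close>

text \<open>
  For monic f = X^n + a_1 X^(n-1) + ... + a_n this is psi(-a_1) [(-1)^n a_n], where a_1 is the
  coefficient of \<open>reflect_poly f\<close> at 1. For the characteristic polynomial of t in k_E over k_F
  it is psi(Tr t) [Nr t].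
\<close>
definition monic_char :: "('a::field \<Rightarrow> complex) \<Rightarrow> 'a poly \<Rightarrow> 'a monoid_alg" where
  "monic_char \<psi> f = Poly_Mapping.single (Mult ((-1) ^ degree f * coeff f 0)) (\<psi> (- coeff (reflect_poly f) 1))"

definition gauss_elem :: "('a::{finite,field} \<Rightarrow> complex) \<Rightarrow> 'a monoid_alg" where
  "gauss_elem \<psi> = (\<Sum>s\<in>UNIV. Poly_Mapping.single (Mult s) (\<psi> s))"

lemma add_monom_mem_monics:
  assumes f: "f \<in> monics n" and "m < n"
  shows "f + monom c m \<in> monics n"
proof -
  have "coeff (f + monom c m) n = 1"
    using mem_monicsD[OF f] assms(2) by (simp add: coeff_monom)
  moreover have "coeff (f + monom c m) j = 0" if "j > n" for j
    using mem_monicsD[OF f] assms(2) that by (simp add: coeff_monom coeff_eq_0)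
  ultimately have "degree (f + monom c m) = n"
    by (intro antisym degree_le le_degree) auto
  with \<open>coeff (f + monom c m) n = 1\<close> show ?thesis
    by (simp add: monics_def)
qed

locale add_char =
  fixes \<psi> :: "'a::{finite,field} \<Rightarrow> complex"
  assumes char_add: "\<And>x y. \<psi> (x + y) = \<psi> x * \<psi> y"
    and char_0: "\<psi> 0 = 1"
    and nontriv: "\<exists>x. \<psi> x \<noteq> 1"
begin

lemma char_sum: "\<psi> (sum f A) = (\<Prod>i\<in>A. \<psi> (f i))"
  by (induction A rule: infinite_finite_induct) (auto simp: char_0 char_add)

lemma monic_multiplicative_monic_char: "monic_multiplicative (monic_char \<psi>)"
  unfolding monic_multiplicative_def
proof (intro conjI allI impI)
  show "monic_char \<psi> 1 = 1"
    by (simp add: monic_char_def char_0)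
next
  fix f g :: "'a poly"
  assume monic: "lead_coeff f = 1" "lead_coeff g = 1"
  hence "f \<noteq> 0" "g \<noteq> 0"
    by auto
  have "(-1) ^ degree (f * g) * coeff (f * g) 0 = (-1) ^ degree f * coeff f 0 * ((-1) ^ degree g * coeff g 0)"
    using \<open>f \<noteq> 0\<close> \<open>g \<noteq> 0\<close> by (simp add: degree_mult_eq coeff_mult_0 power_add algebra_simps)
  moreover have "- coeff (reflect_poly (f * g)) 1 = (- coeff (reflect_poly f) 1) + (- coeff (reflect_poly g) 1)"
    using coeff_reflect_poly_1_mult[OF monic] by simp
  hence "\<psi> (- coeff (reflect_poly (f * g)) 1) = \<psi> (- coeff (reflect_poly f) 1) * \<psi> (- coeff (reflect_poly g) 1)"
    by (simp only: char_add)
  ultimately show "monic_char \<psi> (f * g) = monic_char \<psi> f * monic_char \<psi> g"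
    by (simp add: monic_char_def single_Mult_mult)
qed

lemma sum_monic_char_monics_0: "(\<Sum>f\<in>monics 0. monic_char \<psi> f) = 1"
proof -
  have "monics 0 = {1 :: 'a poly}"
    by (auto simp: monics_def elim!: degree_eq_zeroE)
  thus ?thesis
    using monic_multiplicative_monic_char by (simp add: monic_multiplicative_def)
qed

lemma sum_monic_char_monics_1: "(\<Sum>f\<in>monics 1. monic_char \<psi> f) = gauss_elem \<psi>"
proof -
  have "monics 1 = range (\<lambda>s::'a. [:-s, 1:])"
  proof (intro equalityI subsetI)
    fix f :: "'a poly"
    assume "f \<in> monics 1"
    hence "f = [:- (- coeff f 0), 1:]"
      by (intro poly_eqI) (auto simp: monics_def coeff_pCons coeff_eq_0 split: nat.split)
    thus "f \<in> range (\<lambda>s. [:-s, 1:])"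
      by (rule image_eqI) simp
  qed (auto simp: monics_def)
  moreover have "inj (\<lambda>s::'a. [:-s, 1:])"
    by (auto intro: injI)
  ultimately show ?thesis
    by (simp add: sum.reindex gauss_elem_def monic_char_def coeff_reflect_poly)
qed

text \<open>
  For n >= 2, shifting a_1 by a constant permutes the monics of degree n, keeps a_n and
  multiplies every coefficient of \<open>monic_char\<close> by \<open>\<psi> c\<close>, which may be chosen \<open>\<noteq> 1\<close>.
\<close>
lemma lookup_monic_char_shift:
  assumes "f \<in> monics n" "n \<ge> 2"
  shows "Poly_Mapping.lookup (monic_char \<psi> (f + monom (- c) (n - 1))) k =
    \<psi> c * Poly_Mapping.lookup (monic_char \<psi> f) k"
proof -
  have "degree (f + monom (- c) (n - 1)) = n" "degree f = n"
    using assms add_monom_mem_monics[OF assms(1), of "n - 1"] by (simp_all add: mem_monicsD)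
  moreover have "\<psi> (- coeff (reflect_poly (f + monom (- c) (n - 1))) 1) = \<psi> c * \<psi> (- coeff (reflect_poly f) 1)"
    using calculation assms(2) by (simp add: coeff_reflect_poly coeff_monom char_add[symmetric] add_ac)
  ultimately show ?thesis
    using assms(2) by (simp add: monic_char_def lookup_single when_def coeff_monom)
qed

lemma sum_monic_char_monics_eq_0:
  assumes "n \<ge> 2"
  shows "(\<Sum>f\<in>monics n. monic_char \<psi> f) = 0"
proof (rule poly_mapping_eqI)
  fix k
  obtain c where "\<psi> c \<noteq> 1"
    using nontriv by blast
  have "bij_betw (\<lambda>f. f + monom (- c) (n - 1)) (monics n) (monics n)"
    by (rule bij_betw_byWitness[where f' = "\<lambda>f. f + monom c (n - 1)"])
      (use assms in \<open>auto simp: add_monom_mem_monics add.assoc add_monom\<close>)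
  hence "(\<Sum>f\<in>monics n. Poly_Mapping.lookup (monic_char \<psi> f) k) =
      (\<Sum>f\<in>monics n. Poly_Mapping.lookup (monic_char \<psi> (f + monom (- c) (n - 1))) k)"
    by (rule sum.reindex_bij_betw[symmetric])
  also have "\<dots> = (\<Sum>f\<in>monics n. \<psi> c * Poly_Mapping.lookup (monic_char \<psi> f) k)"
    using assms by (intro sum.cong refl lookup_monic_char_shift)
  also have "\<dots> = \<psi> c * (\<Sum>f\<in>monics n. Poly_Mapping.lookup (monic_char \<psi> f) k)"
    by (simp add: sum_distrib_left)
  finally have "(1 - \<psi> c) * (\<Sum>f\<in>monics n. Poly_Mapping.lookup (monic_char \<psi> f) k) = 0"
    by (simp add: algebra_simps)
  with \<open>\<psi> c \<noteq> 1\<close> show "Poly_Mapping.lookup (\<Sum>f\<in>monics n. monic_char \<psi> f) k = Poly_Mapping.lookup 0 k"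
    by (simp add: lookup_sum)
qed

text \<open>
  Since sum_f monic_char(f) T^(deg f) = 1 + gamma T, the recurrence of \<open>monics_log_derivative\<close>
  collapses to N_1 = gamma and N_(m+1) = -N_m gamma for the left-hand sides N_m.
\<close>
lemma sum_prime_power_pairs_monic_char:
  assumes "m \<ge> 1"
  shows "(\<Sum>x\<in>prime_power_pairs m. of_nat (degree (fst x)) * monic_char \<psi> (fst x) ^ snd x) =
    - ((- gauss_elem \<psi>) ^ m)"
proof -
  define N where "N m = (\<Sum>x\<in>prime_power_pairs m. of_nat (degree (fst x)) * monic_char \<psi> (fst x) ^ snd x)"
    for m
  define L where "L m = (\<Sum>f\<in>monics m. monic_char \<psi> f)" for m
  note L_simps = L_def sum_monic_char_monics_0 sum_monic_char_monics_1[simplified]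
  have recurrence: "of_nat m * L m = (\<Sum>j\<in>{1..m}. N j * L (m - j))" for m
    unfolding N_def L_def by (rule monics_log_derivative[OF monic_multiplicative_monic_char])
  have N_1: "N 1 = gauss_elem \<psi>"
    using recurrence[of 1] by (simp add: L_simps N_def)
  have N_Suc: "N (Suc m) = - (N m * gauss_elem \<psi>)" if "m \<ge> 1" for m
  proof -
    have "{1..Suc m} = insert (Suc m) (insert m {1..m - 1})"
      using that by auto
    moreover have "L (Suc m - j) = 0" if "j \<in> {1..m - 1}" for j
      unfolding L_def using that by (intro sum_monic_char_monics_eq_0) auto
    ultimately have "0 = N (Suc m) * L 0 + N m * L 1"
      using recurrence[of "Suc m"] that sum_monic_char_monics_eq_0[of "Suc m"]
      by (simp add: L_def)
    thus ?thesis
      by (simp add: L_simps eq_neg_iff_add_eq_0 add.commute)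
  qed
  from assms have "N m = - ((- gauss_elem \<psi>) ^ m)"
  proof (induction m rule: dec_induct)
    case base
    show ?case
      using N_1 by simp
  next
    case (step m)
    with N_Suc show ?case
      by (simp add: algebra_simps)
  qed
  thus ?thesis
    by (simp add: N_def)
qed

end

section \<open>Finite field extensions\<close>

lemma prod_lessThan_periodic:
  fixes g :: "nat \<Rightarrow> 'c::comm_monoid_mult"
  assumes periodic: "\<And>i. g (i + e) = g i"
  shows "(\<Prod>i<m * e. g i) = (\<Prod>i<e. g i) ^ m"
proof (induction m)
  case (Suc m)
  have shifted: "g (i + m * e) = g i" for i
    by (induction m arbitrary: i) (simp_all add: add.assoc[symmetric] periodic)
  have "(\<Prod>i<Suc m * e. g i) = (\<Prod>i\<in>{0..<m * e}. g i) * (\<Prod>i\<in>{m * e..<Suc m * e}. g i)"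
    by (subst prod.atLeastLessThan_concat) (auto simp: atLeast0LessThan)
  also have "(\<Prod>i\<in>{m * e..<Suc m * e}. g i) = (\<Prod>i\<in>{0 + m * e..<e + m * e}. g i)"
    by (simp add: add.commute)
  also have "\<dots> = (\<Prod>i<e. g i)"
    by (simp only: prod.shift_bounds_nat_ivl shifted atLeast0LessThan)
  finally show ?case
    using Suc by (simp add: atLeast0LessThan mult.commute)
qed simp

locale finite_field_extension =
  fixes \<iota> :: "'f::{finite,field} \<Rightarrow> 'e::{finite,field}" and r :: nat
  assumes emb_add: "\<And>x y. \<iota> (x + y) = \<iota> x + \<iota> y"
    and emb_mult: "\<And>x y. \<iota> (x * y) = \<iota> x * \<iota> y"
    and emb_1: "\<iota> 1 = 1"
    and degree: "CARD('e) = CARD('f) ^ r"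
begin

lemma emb_0 [simp]: "\<iota> 0 = 0"
  using emb_add[of 0 0] by (metis add.right_neutral add_left_cancel)

lemma emb_uminus [simp]: "\<iota> (- x) = - \<iota> x"
  by (metis emb_add emb_0 add.right_inverse neg_eq_iff_add_eq_0)

lemma emb_power: "\<iota> (x ^ n) = \<iota> x ^ n"
  by (induction n) (simp_all add: emb_mult emb_1)

lemma emb_of_nat: "\<iota> (of_nat n) = of_nat n"
  by (induction n) (simp_all add: emb_add emb_1)

lemma inj_emb: "inj \<iota>"
proof (rule injI)
  fix x y
  assume "\<iota> x = \<iota> y"
  hence "\<iota> (x - y) = 0"
    using emb_add[of "x - y" y] by simp
  show "x = y"
  proof (rule ccontr)
    assume "x \<noteq> y"
    hence "\<iota> (x - y) * \<iota> (inverse (x - y)) = 1"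
      by (simp flip: emb_mult add: emb_1)
    with \<open>\<iota> (x - y) = 0\<close> show False
      by simp
  qed
qed

lemma emb_eq_iff [simp]: "\<iota> x = \<iota> y \<longleftrightarrow> x = y"
  using inj_emb by (auto dest: injD)

lemma emb_eq_0_iff [simp]: "\<iota> x = 0 \<longleftrightarrow> x = 0"
  using emb_eq_iff[of x 0] by simp

lemma inv_emb [simp]: "inv \<iota> (\<iota> x) = x"
  using inj_emb by simp

lemma inv_emb_0 [simp]: "inv \<iota> 0 = 0"
  using inv_emb[of 0] by simp

lemma degree_pos: "r > 0"
  using degree card_field_ge_2[where 'a = 'e] by (cases r) auto

subsection \<open>The Frobenius automorphism \<open>y \<mapsto> y ^ CARD('f)\<close> of \<open>'e\<close> over \<open>'f\<close>\<close>

lemma frob_add: "(x + y :: 'e) ^ CARD('f) = x ^ CARD('f) + y ^ CARD('f)"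
proof -
  have "(x + y) ^ CARD('f) = (\<Sum>k\<le>CARD('f). of_nat (CARD('f) choose k) * x ^ k * y ^ (CARD('f) - k))"
    by (rule binomial_ring)
  also have "\<dots> = (\<Sum>k\<in>{0, CARD('f)}. of_nat (CARD('f) choose k) * x ^ k * y ^ (CARD('f) - k))"
  proof (intro sum.mono_neutral_right ballI)
    fix k
    assume "k \<in> {..CARD('f)} - {0, CARD('f)}"
    hence "of_nat (CARD('f) choose k) = \<iota> 0"
      by (subst of_nat_card_choose_eq_0[symmetric]) (auto simp: emb_of_nat)
    thus "of_nat (CARD('f) choose k) * x ^ k * y ^ (CARD('f) - k) = 0"
      by simp
  qed auto
  finally show ?thesis
    using card_field_ge_2[where 'a = 'f] by (simp add: add_ac)
qed

lemma frob_power_add: "(x + y :: 'e) ^ (CARD('f) ^ i) = x ^ (CARD('f) ^ i) + y ^ (CARD('f) ^ i)"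
  by (induction i arbitrary: x y) (simp_all add: power_mult frob_add)

lemma frob_sum: "(sum f A :: 'e) ^ (CARD('f) ^ i) = (\<Sum>x\<in>A. f x ^ (CARD('f) ^ i))"
  by (induction A rule: infinite_finite_induct) (auto simp: frob_power_add)

lemma frob_uminus: "(- x :: 'e) ^ CARD('f) = - (x ^ CARD('f))"
  using frob_add[of "- x" x] by (simp add: eq_neg_iff_add_eq_0 power_0_left)

lemma frob_power_degree: "(y :: 'e) ^ (CARD('f) ^ r) = y"
  using power_card_eq_self[of y] degree by simp

lemma frob_power_frob_power: "(t ^ (CARD('f) ^ i)) ^ (CARD('f) ^ j) = (t :: 'e) ^ (CARD('f) ^ (i + j))"
  by (simp add: power_mult[symmetric] power_add)

lemma frob_emb: "\<iota> x ^ (CARD('f) ^ i) = \<iota> x"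
  by (simp add: emb_power[symmetric] power_card_power_eq_self)

text \<open>The fixed field of the Frobenius: \<open>X\<^sup>q - X\<close> has at most \<open>q\<close> roots, and \<open>\<iota>\<close> supplies \<open>q\<close> of them.\<close>
lemma range_emb: "range \<iota> = {y :: 'e. y ^ CARD('f) = y}"
proof (rule card_seteq)
  show "range \<iota> \<subseteq> {y :: 'e. y ^ CARD('f) = y}"
    using frob_emb[of _ 1] by auto
  define p :: "'e poly" where "p = monom 1 CARD('f) - monom 1 1"
  have "coeff p CARD('f) = 1"
    using card_field_ge_2[where 'a = 'f] by (simp add: p_def coeff_monom)
  hence "p \<noteq> 0"
    by auto
  have "degree p \<le> CARD('f)"
    unfolding p_def using card_field_ge_2[where 'a = 'f] by (intro degree_diff_le) (auto simp: degree_monom_eq)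
  moreover have "{y :: 'e. y ^ CARD('f) = y} = {y. poly p y = 0}"
    by (simp add: p_def poly_monom)
  ultimately have "card {y :: 'e. y ^ CARD('f) = y} \<le> CARD('f)"
    using card_poly_roots_bound[OF \<open>p \<noteq> 0\<close>] by simp
  thus "card {y :: 'e. y ^ CARD('f) = y} \<le> card (range \<iota>)"
    using inj_emb by (simp add: card_image)
qed simp

lemma degree_map_emb [simp]: "degree (map_poly \<iota> p) = degree p"
  by (rule degree_map_poly) simp

lemma lead_coeff_map_emb [simp]: "lead_coeff (map_poly \<iota> p) = \<iota> (lead_coeff p)"
  by (simp add: coeff_map_poly)

lemma map_emb_mult: "map_poly \<iota> (p * q) = map_poly \<iota> p * map_poly \<iota> q"
  by (rule map_poly_hom_mult) (simp_all add: emb_add emb_mult)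

lemma map_emb_power: "map_poly \<iota> (p ^ k) = map_poly \<iota> p ^ k"
  by (rule map_poly_hom_power) (simp_all add: emb_add emb_mult emb_1)

lemma poly_map_emb_frob:
  "poly (map_poly \<iota> P) (y ^ (CARD('f) ^ i)) = poly (map_poly \<iota> P) y ^ (CARD('f) ^ i)"
proof -
  have "poly (map_poly \<iota> P) y ^ (CARD('f) ^ i) =
      (\<Sum>k\<le>degree P. (coeff (map_poly \<iota> P) k * y ^ k) ^ (CARD('f) ^ i))"
    by (simp add: poly_altdef frob_sum)
  also have "\<dots> = (\<Sum>k\<le>degree P. coeff (map_poly \<iota> P) k * (y ^ (CARD('f) ^ i)) ^ k)"
    by (intro sum.cong refl) (simp add: power_mult_distrib coeff_map_poly frob_emb mult.commute flip: power_mult)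
  finally show ?thesis
    by (simp add: poly_altdef)
qed

subsection \<open>Frobenius orbits and minimal polynomials\<close>

definition frob_period :: "'e \<Rightarrow> nat" where
  "frob_period t = (LEAST e. 0 < e \<and> t ^ (CARD('f) ^ e) = t)"

lemma frob_period: "0 < frob_period t" "t ^ (CARD('f) ^ frob_period t) = t"
proof -
  have "0 < r \<and> t ^ (CARD('f) ^ r) = t"
    using degree_pos frob_power_degree by simp
  thus "0 < frob_period t" "t ^ (CARD('f) ^ frob_period t) = t"
    unfolding frob_period_def by (metis (mono_tags, lifting) LeastI)+
qed

lemma frob_period_least: "0 < e \<Longrightarrow> e < frob_period t \<Longrightarrow> t ^ (CARD('f) ^ e) \<noteq> t"
  unfolding frob_period_def using not_less_Least by blast

lemma frob_power_add_period: "t ^ (CARD('f) ^ (i + frob_period t)) = t ^ (CARD('f) ^ i)"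
  using frob_power_frob_power[of t "frob_period t" i] frob_period(2)[of t] by (simp add: add.commute)

lemma frob_power_mod_period: "t ^ (CARD('f) ^ i) = t ^ (CARD('f) ^ (i mod frob_period t))"
proof (induction i rule: less_induct)
  case (less i)
  show ?case
  proof (cases "i < frob_period t")
    case False
    then obtain j where j: "i = j + frob_period t"
      by (metis add.commute le_Suc_ex not_less)
    with frob_period(1)[of t] show ?thesis
      using less.IH[of j] frob_power_add_period[of t j] by simp
  qed simp
qed

lemma frob_period_dvd_degree: "frob_period t dvd r"
proof -
  have "t ^ (CARD('f) ^ (r mod frob_period t)) = t"
    using frob_power_mod_period[of t r] frob_power_degree by simp
  with frob_period(1)[of t] frob_period_least[of "r mod frob_period t" t] have "r mod frob_period t = 0"
    by (meson mod_less_divisor neq0_conv)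
  thus ?thesis
    by (simp add: mod_eq_0_iff_dvd)
qed

lemma inj_on_frob_orbit: "inj_on (\<lambda>i. t ^ (CARD('f) ^ i)) {..<frob_period t}"
proof -
  have "t ^ (CARD('f) ^ i) \<noteq> t ^ (CARD('f) ^ j)" if "i < j" "j < frob_period t" for i j
  proof
    assume "t ^ (CARD('f) ^ i) = t ^ (CARD('f) ^ j)"
    hence "t ^ (CARD('f) ^ (i + (frob_period t - j))) = t ^ (CARD('f) ^ (j + (frob_period t - j)))"
      by (simp flip: frob_power_frob_power)
    with that frob_period(2)[of t] have "t ^ (CARD('f) ^ (i + (frob_period t - j))) = t"
      by simp
    with that show False
      using frob_period_least[of "i + (frob_period t - j)" t] by linarith
  qed
  thus ?thesis
    by (intro inj_onI) (metis lessThan_iff linorder_neqE_nat)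
qed

definition conj_poly :: "'e \<Rightarrow> 'e poly" where
  "conj_poly t = (\<Prod>i<frob_period t. [:- (t ^ (CARD('f) ^ i)), 1:])"

lemma lead_coeff_conj_poly: "lead_coeff (conj_poly t) = 1"
  by (simp add: conj_poly_def lead_coeff_prod)

lemma degree_conj_poly: "degree (conj_poly t) = frob_period t"
  by (simp add: conj_poly_def degree_prod_sum_eq)

lemma poly_conj_poly_self: "poly (conj_poly t) t = 0"
  using frob_period(1)[of t] by (auto simp: conj_poly_def poly_prod intro!: bexI[of _ 0])

lemma map_frob_conj_poly: "map_poly (\<lambda>c. c ^ CARD('f)) (conj_poly t) = conj_poly t"
proof -
  define g where "g i = [:- (t ^ (CARD('f) ^ i)), 1:]" for i
  have "map_poly (\<lambda>c. c ^ CARD('f)) (g i) = g (Suc i)" for i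
    by (intro poly_eqI)
      (simp add: g_def coeff_map_poly coeff_pCons frob_uminus power_mult[symmetric] mult.commute split: nat.split)
  hence "map_poly (\<lambda>c. c ^ CARD('f)) (conj_poly t) = (\<Prod>i<frob_period t. g (Suc i))"
    unfolding conj_poly_def g_def[symmetric]
    by (subst map_poly_hom_prod) (simp_all add: frob_add power_mult_distrib)
  also have "\<dots> = (\<Prod>i<frob_period t. g i)"
  proof -
    obtain n where n: "frob_period t = Suc n"
      using frob_period(1)[of t] gr0_implies_Suc by blast
    have "g (Suc n) = g 0"
      using frob_period(2)[of t] n by (simp add: g_def)
    hence "(\<Prod>i<Suc n. g (Suc i)) = g 0 * (\<Prod>i<n. g (Suc i))"
      by (simp add: mult.commute)
    also have "\<dots> = (\<Prod>i<Suc n. g i)"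
      by (rule prod.lessThan_Suc_shift[symmetric])
    finally show ?thesis
      using n by simp
  qed
  finally show ?thesis
    by (simp add: conj_poly_def g_def)
qed

lemma coeff_conj_poly_in_range: "coeff (conj_poly t) k \<in> range \<iota>"
proof -
  have "coeff (conj_poly t) k ^ CARD('f) = coeff (conj_poly t) k"
    using arg_cong[OF map_frob_conj_poly[of t], of "\<lambda>p. coeff p k"] by (simp add: coeff_map_poly)
  thus ?thesis
    by (simp add: range_emb)
qed

definition min_poly :: "'e \<Rightarrow> 'f poly" where
  "min_poly t = map_poly (inv \<iota>) (conj_poly t)"

lemma map_emb_min_poly: "map_poly \<iota> (min_poly t) = conj_poly t"
  unfolding min_poly_def using coeff_conj_poly_in_range[of t]
  by (intro poly_eqI) (simp add: coeff_map_poly f_inv_into_f)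

lemma lead_coeff_min_poly: "lead_coeff (min_poly t) = 1"
proof -
  have "\<iota> (lead_coeff (min_poly t)) = \<iota> 1"
    using lead_coeff_map_emb[of "min_poly t"] by (simp add: map_emb_min_poly lead_coeff_conj_poly emb_1)
  thus ?thesis
    by simp
qed

lemma degree_min_poly: "degree (min_poly t) = frob_period t"
  using arg_cong[OF map_emb_min_poly[of t], of degree] by (simp add: degree_conj_poly)

text \<open>A root of a polynomial over \<open>'f\<close> brings its whole Frobenius orbit along.\<close>
lemma frob_period_le_degree:
  assumes "c \<noteq> 0" and root: "poly (map_poly \<iota> c) t = 0"
  shows "frob_period t \<le> degree c"
proof -
  have "map_poly \<iota> c \<noteq> 0"
    using assms(1) by (simp add: map_poly_eq_0_iff)
  have "frob_period t = card ((\<lambda>i. t ^ (CARD('f) ^ i)) ` {..<frob_period t})"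
    by (simp add: card_image[OF inj_on_frob_orbit])
  also have "\<dots> \<le> card {x. poly (map_poly \<iota> c) x = 0}"
    using root by (intro card_mono) (auto simp: poly_roots_finite \<open>map_poly \<iota> c \<noteq> 0\<close> poly_map_emb_frob)
  also have "\<dots> \<le> degree c"
    using card_poly_roots_bound[OF \<open>map_poly \<iota> c \<noteq> 0\<close>] by simp
  finally show ?thesis .
qed

lemma irreducible_min_poly: "irreducible (min_poly t)"
proof (rule irreducibleI)
  show "min_poly t \<noteq> 0"
    using lead_coeff_min_poly[of t] by auto
  thus "\<not> is_unit (min_poly t)"
    using frob_period(1)[of t] by (simp add: is_unit_iff_degree degree_min_poly)
  fix a b
  assume ab: "min_poly t = a * b"
  with \<open>min_poly t \<noteq> 0\<close> have "a \<noteq> 0" "b \<noteq> 0"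
    by auto
  have deg: "degree a + degree b = frob_period t"
    using ab \<open>a \<noteq> 0\<close> \<open>b \<noteq> 0\<close> by (simp add: degree_min_poly[symmetric] degree_mult_eq)
  have "poly (map_poly \<iota> a) t * poly (map_poly \<iota> b) t = 0"
    using poly_conj_poly_self[of t] by (simp add: map_emb_min_poly[symmetric] ab map_emb_mult)
  hence "frob_period t \<le> degree a \<or> frob_period t \<le> degree b"
    using frob_period_le_degree \<open>a \<noteq> 0\<close> \<open>b \<noteq> 0\<close> by auto
  thus "is_unit a \<or> is_unit b"
    using deg \<open>a \<noteq> 0\<close> \<open>b \<noteq> 0\<close> by (auto simp: is_unit_iff_degree)
qed

text \<open>The characteristic polynomial of multiplication by \<open>t\<close> on \<open>'e\<close> over \<open>'f\<close>.\<close>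
definition char_poly :: "'e \<Rightarrow> 'e poly" where
  "char_poly t = (\<Prod>i<r. [:- (t ^ (CARD('f) ^ i)), 1:])"

lemma char_poly_eq_conj_poly_power: "char_poly t = conj_poly t ^ (r div frob_period t)"
proof -
  have "r = (r div frob_period t) * frob_period t"
    using frob_period_dvd_degree[of t] by simp
  hence "char_poly t = (\<Prod>i<(r div frob_period t) * frob_period t. [:- (t ^ (CARD('f) ^ i)), 1:])"
    unfolding char_poly_def by simp
  also have "\<dots> = conj_poly t ^ (r div frob_period t)"
    unfolding conj_poly_def by (rule prod_lessThan_periodic) (simp add: frob_power_add_period)
  finally show ?thesis .
qed

lemma degree_char_poly: "degree (char_poly t) = r"
  by (simp add: char_poly_def degree_prod_sum_eq)

lemma coeff_0_char_poly: "coeff (char_poly t) 0 = (-1) ^ r * (\<Prod>i<r. t ^ (CARD('f) ^ i))"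
  by (simp add: char_poly_def poly_0_coeff_0[symmetric] poly_prod prod_uminus)

lemma coeff_1_reflect_char_poly: "coeff (reflect_poly (char_poly t)) 1 = - (\<Sum>i<r. t ^ (CARD('f) ^ i))"
proof -
  have reflect_linear: "reflect_poly [:- a, 1:] = [:1, - a:]" for a :: 'e
    by (intro poly_eqI) (auto simp: coeff_reflect_poly coeff_pCons split: nat.split)
  have "coeff (\<Prod>i\<in>A. [:1, - a i:]) 0 = 1 \<and> coeff (\<Prod>i\<in>A. [:1, - a i:]) 1 = - (\<Sum>i\<in>A. a i)"
    if "finite A" for A and a :: "nat \<Rightarrow> 'e"
    using that by (induction A rule: finite_induct) (simp_all add: mult_pCons_left coeff_pCons)
  thus ?thesis
    by (simp add: char_poly_def reflect_poly_prod reflect_linear)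
qed

lemma monic_char_min_poly_power:
  "monic_char \<psi> (min_poly t ^ (r div frob_period t)) =
     Poly_Mapping.single (Mult (fin_norm \<iota> r t)) (\<psi> (fin_trace \<iota> r t))"
proof -
  define g where "g = min_poly t ^ (r div frob_period t)"
  have map_g: "map_poly \<iota> g = char_poly t"
    by (simp add: g_def map_emb_power map_emb_min_poly char_poly_eq_conj_poly_power)
  hence deg_g: "degree g = r"
    using degree_char_poly[of t] degree_map_emb[of g] by simp
  have "\<iota> ((-1) ^ degree g * coeff g 0) = (-1) ^ r * coeff (char_poly t) 0"
    using deg_g by (simp add: emb_mult emb_power emb_1 coeff_map_poly flip: map_g)
  also have "\<dots> = (\<Prod>i<r. t ^ (CARD('f) ^ i))"
    by (simp add: coeff_0_char_poly power_mult_distrib[symmetric])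
  finally have norm: "(-1) ^ degree g * coeff g 0 = fin_norm \<iota> r t"
    unfolding fin_norm_def by (metis inv_emb)
  have "\<iota> (- coeff (reflect_poly g) 1) = - coeff (char_poly t) (r - 1)"
    using deg_g degree_pos by (simp add: coeff_reflect_poly coeff_map_poly flip: map_g)
  also have "\<dots> = (\<Sum>i<r. t ^ (CARD('f) ^ i))"
    using coeff_1_reflect_char_poly[of t] degree_char_poly[of t] degree_pos by (simp add: coeff_reflect_poly)
  finally have trace: "- coeff (reflect_poly g) 1 = fin_trace \<iota> r t"
    unfolding fin_trace_def by (metis inv_emb)
  show ?thesis
    unfolding g_def[symmetric] monic_char_def norm trace ..
qed

lemma trace_sum_in_range: "(\<Sum>i<r. (x :: 'e) ^ (CARD('f) ^ i)) \<in> range \<iota>"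
proof -
  obtain r' where r': "r = Suc r'"
    using degree_pos gr0_implies_Suc by blast
  have "(\<Sum>i<r. x ^ (CARD('f) ^ i)) ^ CARD('f) = (\<Sum>i<r. (x ^ (CARD('f) ^ i)) ^ CARD('f))"
    using frob_sum[of _ _ 1] by simp
  also have "\<dots> = (\<Sum>i<r. x ^ (CARD('f) ^ Suc i))"
    by (simp add: power_mult[symmetric] mult.commute)
  also have "\<dots> = (\<Sum>i<r'. x ^ (CARD('f) ^ Suc i)) + x ^ (CARD('f) ^ 0)"
    using frob_power_degree[of x] by (simp add: r')
  also have "\<dots> = (\<Sum>i<r. x ^ (CARD('f) ^ i))"
    unfolding r' sum.lessThan_Suc_shift by (rule add.commute)
  finally show ?thesis
    by (simp add: range_emb)
qed

lemma fin_trace_add: "fin_trace \<iota> r (x + y) = fin_trace \<iota> r x + fin_trace \<iota> r y"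
proof -
  obtain a b where a: "(\<Sum>i<r. x ^ (CARD('f) ^ i)) = \<iota> a" and b: "(\<Sum>i<r. y ^ (CARD('f) ^ i)) = \<iota> b"
    using trace_sum_in_range[of x] trace_sum_in_range[of y] by blast
  have "(\<Sum>i<r. (x + y) ^ (CARD('f) ^ i)) = \<iota> (a + b)"
    by (simp add: frob_power_add sum.distrib a b emb_add)
  thus ?thesis
    unfolding fin_trace_def a b by simp
qed

lemma fin_trace_0: "fin_trace \<iota> r 0 = 0"
proof -
  have "(\<Sum>i<r. (0 :: 'e) ^ (CARD('f) ^ i)) = 0"
    by (simp add: power_0_left)
  thus ?thesis
    by (simp add: fin_trace_def)
qed

lemma fin_trace_sum: "fin_trace \<iota> r (sum f A) = (\<Sum>i\<in>A. fin_trace \<iota> r (f i))"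
  by (induction A rule: infinite_finite_induct) (simp_all add: fin_trace_0 fin_trace_add)

end

section \<open>Kloosterman sums as coefficients\<close>

locale kloosterman_setting = finite_field_extension \<iota> r + add_char \<psi>
  for \<iota> :: "'f::{finite,field} \<Rightarrow> 'e::{finite,field}" and r and \<psi> :: "'f \<Rightarrow> complex"
begin

definition norm_trace_elem :: "'f monoid_alg" where
  "norm_trace_elem =
     (\<Sum>t\<in>(UNIV :: 'e set). Poly_Mapping.single (Mult (fin_norm \<iota> r t)) (\<psi> (fin_trace \<iota> r t)))"

text \<open>The characteristic polynomial of \<open>t\<close>, as a power of its minimal polynomial.\<close>
definition min_poly_power :: "'e \<Rightarrow> 'f poly \<times> nat" where
  "min_poly_power t = (min_poly t, r div frob_period t)"

lemma min_poly_power_in_prime_power_pairs: "min_poly_power t \<in> prime_power_pairs r"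
proof -
  have "frob_period t \<le> r"
    using frob_period_dvd_degree[of t] degree_pos by (rule dvd_imp_le)
  with frob_period(1)[of t] have "1 \<le> r div frob_period t"
    by (simp add: div_greater_zero_iff Suc_le_eq)
  moreover have "r div frob_period t * degree (min_poly t) = r"
    using frob_period_dvd_degree[of t] by (simp add: degree_min_poly)
  ultimately show ?thesis
    using lead_coeff_min_poly[of t] irreducible_min_poly[of t]
    by (simp add: min_poly_power_def prime_power_pairs_def)
qed

lemma card_min_poly_power_fiber_le:
  assumes "y \<in> prime_power_pairs r"
  shows "card {t. min_poly_power t = y} \<le> degree (fst y)"
proof -
  have "map_poly \<iota> (fst y) \<noteq> 0"
    using assms by (auto simp: prime_power_pairs_def map_poly_eq_0_iff)
  have "{t. min_poly_power t = y} \<subseteq> {t. poly (map_poly \<iota> (fst y)) t = 0}"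
    using map_emb_min_poly poly_conj_poly_self by (auto simp: min_poly_power_def)
  hence "card {t. min_poly_power t = y} \<le> card {t. poly (map_poly \<iota> (fst y)) t = 0}"
    by (intro card_mono) auto
  also have "\<dots> \<le> degree (fst y)"
    using card_poly_roots_bound[OF \<open>map_poly \<iota> (fst y) \<noteq> 0\<close>] by simp
  finally show ?thesis .
qed

text \<open>Equality in every fibre is forced because both sides sum to \<open>CARD('e) = CARD('f) ^ r\<close>.\<close>
lemma card_min_poly_power_fiber:
  assumes "y \<in> prime_power_pairs r"
  shows "card {t. min_poly_power t = y} = degree (fst y)"
proof (rule ccontr)
  assume "card {t. min_poly_power t = y} \<noteq> degree (fst y)"
  with assms card_min_poly_power_fiber_le[OF assms]
  have "\<exists>y\<in>prime_power_pairs r. card {t. min_poly_power t = y} < degree (fst y)"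
    by force
  hence "(\<Sum>y\<in>prime_power_pairs r. card {t. min_poly_power t = y}) <
      (\<Sum>y\<in>prime_power_pairs r. degree (fst y :: 'f poly))"
    using card_min_poly_power_fiber_le by (intro sum_strict_mono_ex1[OF finite_prime_power_pairs]) auto
  also have "\<dots> = (\<Sum>t\<in>(UNIV :: 'e set). 1)"
    using sum_degree_prime_power_pairs[of r] degree_pos degree by simp
  also have "\<dots> = (\<Sum>y\<in>prime_power_pairs r. \<Sum>t\<in>{t \<in> UNIV. min_poly_power t = y}. 1)"
    by (rule sum.group[symmetric]) (auto simp: min_poly_power_in_prime_power_pairs)
  also have "\<dots> = (\<Sum>y\<in>prime_power_pairs r. card {t. min_poly_power t = y})"
    by simp
  finally show False
    by simp
qed

lemma norm_trace_elem_eq: "norm_trace_elem = - ((- gauss_elem \<psi>) ^ r)"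
proof -
  have "norm_trace_elem = (\<Sum>t\<in>UNIV. monic_char \<psi> (fst (min_poly_power t)) ^ snd (min_poly_power t))"
    unfolding norm_trace_elem_def min_poly_power_def
    by (simp add: monic_char_min_poly_power
        monic_multiplicative_power[OF monic_multiplicative_monic_char lead_coeff_min_poly, symmetric])
  also have "\<dots> = (\<Sum>y\<in>prime_power_pairs r. \<Sum>t\<in>{t. min_poly_power t = y}. monic_char \<psi> (fst y) ^ snd y)"
    by (subst sum.group[symmetric, of _ _ min_poly_power])
      (auto simp: min_poly_power_in_prime_power_pairs intro!: sum.cong)
  also have "\<dots> = (\<Sum>y\<in>prime_power_pairs r. of_nat (degree (fst y)) * monic_char \<psi> (fst y) ^ snd y)"
    by (intro sum.cong refl) (simp add: card_min_poly_power_fiber of_nat_def)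
  also have "\<dots> = - ((- gauss_elem \<psi>) ^ r)"
    using sum_prime_power_pairs_monic_char degree_pos by simp
  finally show ?thesis .
qed

lemma Kl_eq_lookup:
  "Kl \<psi> \<iota> r n m a = Poly_Mapping.lookup (norm_trace_elem ^ n * gauss_elem \<psi> ^ m) (Mult a)"
proof -
  define T where "T = ({..<n} \<rightarrow>\<^sub>E (UNIV :: 'e set))"
  define S where "S = ({..<m} \<rightarrow>\<^sub>E (UNIV :: 'f set))"
  define X where "X t = (\<Prod>i<n. fin_norm \<iota> r (t i))" for t
  define Y where "Y s = (\<Prod>j<m. s j)" for s :: "nat \<Rightarrow> 'f"
  define c where "c t s = \<psi> (fin_trace \<iota> r (\<Sum>i<n. t i)) * \<psi> (\<Sum>j<m. s j)" for t s
  have "finite T" "finite S"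
    by (simp_all add: T_def S_def finite_PiE)
  have "norm_trace_elem ^ n * gauss_elem \<psi> ^ m =
      (\<Sum>t\<in>T. \<Sum>s\<in>S. Poly_Mapping.single (Mult (X t * Y s)) (c t s))"
    unfolding norm_trace_elem_def gauss_elem_def power_sum_single_Mult sum_product
    by (simp add: T_def S_def X_def Y_def c_def single_Mult_mult fin_trace_sum char_sum)
  hence "Poly_Mapping.lookup (norm_trace_elem ^ n * gauss_elem \<psi> ^ m) (Mult a) =
      (\<Sum>x\<in>T \<times> S. if X (fst x) * Y (snd x) = a then c (fst x) (snd x) else 0)"
    by (simp add: lookup_sum lookup_single when_def sum.cartesian_product case_prod_beta)
  also have "\<dots> = (\<Sum>x\<in>{x\<in>T \<times> S. X (fst x) * Y (snd x) = a}. c (fst x) (snd x))"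
    using \<open>finite T\<close> \<open>finite S\<close> by (simp add: sum.inter_filter)
  also have "{x\<in>T \<times> S. X (fst x) * Y (snd x) = a} = {(t, s). t \<in> T \<and> s \<in> S \<and> X t * Y s = a}"
    by auto
  finally show ?thesis
    by (simp add: Kl_def T_def S_def X_def Y_def c_def case_prod_beta)
qed

end

text \<open>
  If \<open>\<psi> 0 \<noteq> 1\<close>, then \<open>\<psi> = 0\<close> and all sums vanish.
\<close>
theorem corollaryA6:
  fixes \<iota> :: "'f::{finite,field} \<Rightarrow> 'e::{finite,field}"
    and \<psi> :: "'f \<Rightarrow> complex"
    and r n :: nat and a :: 'f
  assumes hom_add: "\<And>x y. \<iota> (x + y) = \<iota> x + \<iota> y"
    and hom_mult: "\<And>x y. \<iota> (x * y) = \<iota> x * \<iota> y"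
    and hom_one: "\<iota> 1 = 1"
    and degree: "CARD('e) = CARD('f) ^ r"
    and char_add: "\<And>x y. \<psi> (x + y) = \<psi> x * \<psi> y"
    and nontriv: "\<exists>x. \<psi> x \<noteq> 1"
    and a_nz: "a \<noteq> 0"
  shows "Kl \<psi> \<iota> r n r a = (-1) ^ (r - 1) * Kl \<psi> \<iota> r (n + 1) 0 a"
proof (cases "\<psi> 0 = 1")
  case False
  have "\<psi> 0 * (\<psi> 0 - 1) = 0"
    using char_add[of 0 0] by (simp add: algebra_simps)
  with False have "\<psi> x = 0" for x
    using char_add[of x 0] by simp
  thus ?thesis
    by (simp add: Kl_def)
next
  case True
  interpret kloosterman_setting \<iota> r \<psi>
    by unfold_locales (use assms True in auto)
  obtain r' where r': "r = Suc r'"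
    using degree_pos gr0_implies_Suc by blast
  have "norm_trace_elem = (-1) ^ r' * gauss_elem \<psi> ^ r"
    using norm_trace_elem_eq by (simp add: r' power_minus[of "gauss_elem \<psi>"])
  hence "norm_trace_elem ^ (n + 1) * gauss_elem \<psi> ^ 0 = (-1) ^ r' * (norm_trace_elem ^ n * gauss_elem \<psi> ^ r)"
    by (simp add: mult_ac)
  hence "Kl \<psi> \<iota> r (n + 1) 0 a = (-1) ^ r' * Kl \<psi> \<iota> r n r a"
    by (simp only: Kl_eq_lookup lookup_neg_one_power_mult)
  moreover have "(-1) ^ r' * (-1) ^ r' = (1 :: complex)"
    by (simp flip: power_mult_distrib)
  ultimately show ?thesis
    by (simp add: r' mult.assoc[symmetric])
qed

end
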